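(* Let $G_1,G_2,\ldots,G_n$ be a finite sequence of pairwise disjoint connected graphs and let $x_i\in V(G_i)$ for $1\le i\le n$. Let $G=B(G_1,\ldots,G_n)$ be the bouquet of the graphs $\{G_i\}_{i=1}^n$ with respect to the vertices $\{x_i\}_{i=1}^n$, obtained by identifying the vertices $x_1,\ldots,x_n$ with a single vertex $x$. Then $$ABC_{GG}(B(G_1,\ldots,G_n))<|E(G)|+\sum_{i=1}^{n}ABC_{GG}(G_i)+\sum_{i=1}^{n-1}\sqrt{\frac{|V(G)|-2}{\left(\sum_{t=1}^{i}|V(G_t)|\right)\left(\sum_{t=i+1}^{n}|V(G_t)|\right)}}.$$
   Context: All graphs are finite and simple. For an edge $uv$ of a graph $G$, $n_u(uv,G)$ is the number of vertices of $G$ strictly closer (in graph distance in $G$) to $u$ than to $v$, and $n_v(uv,G)$ is defined analogously; equidistant vertices are not counted. $ABC_{GG}(G)=\sum_{uv\in E(G)}\sqrt{\frac{n_u(uv,G)+n_v(uv,G)-2}{n_u(uv,G)n_v(uv,G)}}$ (Graovac-Ghorbani index).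
   Formalization: The bouquet G is assumed to have at least two vertices; if every G_i is a single vertex, the claim reads 0 < 0 for n = 1, and for n ≥ 2 the quantity |V(G)| − 2 under the square root is negative. *)

theory Defs
  imports Complex_Main "Graph_Theory.Graph_Theory"
begin

text \<open>
  A finite simple graph is a \<open>pair_graph\<close>: a finite, symmetric, loop-free digraph without
  parallel arcs. An undirected edge \<open>uv\<close> corresponds to the two arcs \<open>(u, v)\<close> and \<open>(v, u)\<close>,
  so \<open>E(G)\<close> is the set of the unordered pairs \<open>{u, v}\<close>.
\<close>

definition edges :: "'a pair_pre_digraph \<Rightarrow> 'a set set" where
  "edges G = {{u, v} |u v. (u, v) \<in> parcs G}"

text \<open>Every arc has cost 1, so the cost of a walk is its length.\<close>

definition gdist :: "'a pair_pre_digraph \<Rightarrow> 'a \<Rightarrow> 'a \<Rightarrow> ereal" where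
  "gdist G = wf_digraph.\<mu> (with_proj G) (\<lambda>_. 1)"

text \<open>\<open>n_closer G u v\<close> is \<open>n\<^sub>u(uv, G)\<close>; consequently \<open>n\<^sub>v(uv, G)\<close> is \<open>n_closer G v u\<close>.\<close>

definition n_closer :: "'a pair_pre_digraph \<Rightarrow> 'a \<Rightarrow> 'a \<Rightarrow> nat" where
  "n_closer G u v = card {w \<in> pverts G. gdist G w u < gdist G w v}"

text \<open>
  The summand of the index is symmetric in \<open>u\<close> and \<open>v\<close>, hence it is a function of the
  unordered edge; see \<open>ABC_GG_summand_doubleton\<close>.
\<close>

definition ABC_GG_summand :: "'a pair_pre_digraph \<Rightarrow> 'a set \<Rightarrow> real" where
  "ABC_GG_summand G e = (THE r. \<exists>u v. e = {u, v} \<and>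
     r = sqrt ((real (n_closer G u v) + real (n_closer G v u) - 2) /
               (real (n_closer G u v) * real (n_closer G v u))))"

lemma ABC_GG_summand_doubleton:
  "ABC_GG_summand G {u, v} =
     sqrt ((real (n_closer G u v) + real (n_closer G v u) - 2) /
           (real (n_closer G u v) * real (n_closer G v u)))"
  unfolding ABC_GG_summand_def
  by (rule the_equality) (auto simp: doubleton_eq_iff add.commute mult.commute)

definition ABC_GG :: "'a pair_pre_digraph \<Rightarrow> real" where
  "ABC_GG G = (\<Sum>e\<in>edges G. ABC_GG_summand G e)"

text \<open>
  In the bouquet of \<open>G 1, \<dots>, G n\<close>, the map \<open>glue n x z\<close> sends all the vertices
  \<open>x 1, \<dots>, x n\<close> to \<open>z\<close> and fixes every other vertex. It identifies nothing else
  as long as \<open>z\<close> is not one of the other vertices of the graphs; \<open>z\<close> may be new or one of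
  the \<open>x i\<close>.
\<close>

definition glue :: "nat \<Rightarrow> (nat \<Rightarrow> 'a) \<Rightarrow> 'a \<Rightarrow> 'a \<Rightarrow> 'a" where
  "glue n x z v = (if v \<in> x ` {1..n} then z else v)"

definition bouquet ::
  "nat \<Rightarrow> (nat \<Rightarrow> 'a pair_pre_digraph) \<Rightarrow> (nat \<Rightarrow> 'a) \<Rightarrow> 'a \<Rightarrow> 'a pair_pre_digraph" where
  "bouquet n G x z =
     \<lparr>pverts = glue n x z ` (\<Union>i\<in>{1..n}. pverts (G i)),
      parcs = map_prod (glue n x z) (glue n x z) ` (\<Union>i\<in>{1..n}. parcs (G i))\<rparr>"

lemma pair_graph_bouquet:
  assumes gr: "\<And>i. i \<in> {1..n} \<Longrightarrow> pair_graph (G i)"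
    and disj: "disjoint_family_on (\<lambda>i. pverts (G i)) {1..n}"
    and x: "\<And>i. i \<in> {1..n} \<Longrightarrow> x i \<in> pverts (G i)"
    and z: "z \<notin> (\<Union>i\<in>{1..n}. pverts (G i)) - x ` {1..n}"
  shows "pair_graph (bouquet n G x z)"
proof -
  let ?B = "bouquet n G x z" and ?g = "glue n x z"
  have inv: "u \<in> pverts (G i) \<and> v \<in> pverts (G i) \<and> u \<noteq> v \<and> (v, u) \<in> parcs (G i)"
    if i: "i \<in> {1..n}" and uv: "(u, v) \<in> parcs (G i)" for i u v
  proof -
    interpret pair_graph "G i" using gr[OF i] .
    show ?thesis using uv in_arcsD1 in_arcsD2 pair_no_loops[OF uv] arcs_symmetric by auto
  qed
  have fin: "finite (pverts (G i))" "finite (parcs (G i))" if i: "i \<in> {1..n}" for i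
  proof -
    interpret pair_graph "G i" using gr[OF i] .
    show "finite (pverts (G i))" "finite (parcs (G i))"
      using pair_finite_verts pair_finite_arcs by auto
  qed
  have arc: "\<exists>i u v. i \<in> {1..n} \<and> (u, v) \<in> parcs (G i) \<and> e = (?g u, ?g v)"
    if "e \<in> parcs ?B" for e
    using that unfolding bouquet_def by (simp add: image_iff) fastforce
  have arcI: "(?g u, ?g v) \<in> parcs ?B" if "i \<in> {1..n}" "(u, v) \<in> parcs (G i)" for i u v
    using that by (force simp: bouquet_def)
  have vertI: "?g u \<in> pverts ?B" if "i \<in> {1..n}" "u \<in> pverts (G i)" for i u
    using that unfolding bouquet_def by (auto intro!: imageI)
  have only: "u = x i" if i: "i \<in> {1..n}" and u: "u \<in> pverts (G i)" and ux: "u \<in> x ` {1..n}" for i u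
  proof -
    from ux obtain j where j: "j \<in> {1..n}" "u = x j" by auto
    then have "u \<in> pverts (G j)" using x by auto
    then have "i = j" using disj i j(1) u unfolding disjoint_family_on_def by blast
    then show ?thesis using j by simp
  qed
  have inj: "?g u \<noteq> ?g v"
    if i: "i \<in> {1..n}" and u: "u \<in> pverts (G i)" and v: "v \<in> pverts (G i)" and "u \<noteq> v" for i u v
    using only[OF i u] only[OF i v] \<open>u \<noteq> v\<close> z i u v by (auto simp: glue_def)
  show ?thesis
  proof
    fix e assume "e \<in> parcs ?B"
    from arc[OF this] obtain i u v
      where i: "i \<in> {1..n}" and uv: "(u, v) \<in> parcs (G i)" and e: "e = (?g u, ?g v)" by auto
    have "u \<in> pverts (G i)" "v \<in> pverts (G i)" "u \<noteq> v" using inv[OF i uv] by auto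
    then show "fst e \<in> pverts ?B" "snd e \<in> pverts ?B" "fst e \<noteq> snd e"
      using vertI[OF i] inj[OF i] e by auto
  next
    show "finite (pverts ?B)" "finite (parcs ?B)"
      using fin by (auto simp: bouquet_def)
  next
    show "symmetric (with_proj ?B)"
      unfolding symmetric_def with_proj_simps
    proof (rule symI)
      fix a b assume "(a, b) \<in> parcs ?B"
      from arc[OF this] obtain i u v
        where "i \<in> {1..n}" "(u, v) \<in> parcs (G i)" "a = ?g u" "b = ?g v" by auto
      then show "(b, a) \<in> parcs ?B" using inv arcI by simp
    qed
  qed
qed

end

theory Submission
  imports Defs
begin

text \<open>
  Already the term \<open>|E(G)|\<close> exceeds the index of the bouquet. For an edge \<open>uv\<close> of any graph,
  \<open>a = n\<^sub>u\<close> and \<open>b = n\<^sub>v\<close> are at least 1, because \<open>u\<close> is closer to itself than to \<open>v\<close> and vice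
  versa. Hence \<open>ab - (a + b - 2) = (a - 1)(b - 1) + 1 > 0\<close>, so that the summand of \<open>uv\<close> lies
  in \<open>[0, 1)\<close> (\<open>ABC_GG_summand_nonneg\<close>, \<open>ABC_GG_summand_less_one\<close>). Summing over the edges,
  \<open>ABC_GG\<close> is nonnegative, and it is strictly less than the number of edges as soon as there
  is an edge (\<open>ABC_GG_less_card_edges\<close>).

  A bouquet of connected graphs with at least two vertices does have an edge
  (\<open>bouquet_has_edge\<close>), and the other two sums on the right-hand side are nonnegative.
\<close>

lemma gdist_self_le_zero:
  assumes "pair_wf_digraph G" and "u \<in> pverts G"
  shows "gdist G u u \<le> 0"
proof -
  interpret pair_wf_digraph G by fact
  have "awalk u [] u" using assms(2) by (simp add: awalk_Nil_iff)
  then show ?thesis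
    using min_cost_le_walk_cost[of u "[]" u "\<lambda>_. 1"] by (simp add: gdist_def zero_ereal_def)
qed

lemma one_le_gdist:
  assumes "pair_wf_digraph G" and "u \<noteq> v"
  shows "1 \<le> gdist G u v"
proof -
  interpret pair_wf_digraph G by fact
  have "(1::ereal) \<le> ereal (awalk_cost (\<lambda>_. 1) p)" if p: "awalk u p v" for p
  proof -
    have "p \<noteq> []" using p assms(2) by (auto simp: awalk_Nil_iff)
    then obtain e es where "p = e # es" by (cases p) auto
    moreover have "0 \<le> awalk_cost (\<lambda>_. 1) es"
      unfolding awalk_cost_def by (rule sum_list_nonneg) auto
    ultimately show ?thesis by simp
  qed
  then show ?thesis unfolding gdist_def \<mu>_def by (auto intro: INF_greatest)
qed

text \<open>The vertex \<open>u\<close> itself is counted: it has distance 0 to \<open>u\<close> and at least 1 to \<open>v\<close>.\<close>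

lemma n_closer_pos:
  assumes "pair_fin_digraph G" and "u \<in> pverts G" and "u \<noteq> v"
  shows "1 \<le> n_closer G u v"
proof -
  interpret pair_fin_digraph G by fact
  have "gdist G u u \<le> 0"
    by (rule gdist_self_le_zero) (fact pair_wf_digraph_axioms assms(2))+
  also have "0 < gdist G u v"
    using one_le_gdist[OF pair_wf_digraph_axioms assms(3)] by (auto intro: less_le_trans[of 0 1])
  finally have "u \<in> {w \<in> pverts G. gdist G w u < gdist G w v}" using assms(2) by simp
  then have "0 < card {w \<in> pverts G. gdist G w u < gdist G w v}"
    using pair_finite_verts by (auto simp: card_gt_0_iff)
  then show ?thesis by (simp add: n_closer_def)
qed

lemma edge_endpoints_n_closer_pos:
  assumes "pair_graph G" and "e \<in> edges G"
  obtains u v where "e = {u, v}" "1 \<le> n_closer G u v" "1 \<le> n_closer G v u"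
proof -
  interpret pair_graph G by fact
  obtain u v where e: "e = {u, v}" and uv: "(u, v) \<in> parcs G"
    using assms(2) by (auto simp: edges_def)
  have "u \<in> pverts G" "v \<in> pverts G" "u \<noteq> v"
    using in_arcsD1[OF uv] in_arcsD2[OF uv] pair_no_loops[OF uv] by auto
  then show ?thesis
    using that[OF e] n_closer_pos[OF pair_fin_digraph_axioms] by auto
qed

lemma ABC_GG_summand_nonneg:
  assumes "pair_graph G" and "e \<in> edges G"
  shows "0 \<le> ABC_GG_summand G e"
proof -
  obtain u v where "e = {u, v}" "1 \<le> n_closer G u v" "1 \<le> n_closer G v u"
    using edge_endpoints_n_closer_pos[OF assms] .
  then show ?thesis by (simp add: ABC_GG_summand_doubleton)
qed

lemma ABC_GG_summand_less_one:
  assumes "pair_graph G" and "e \<in> edges G"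
  shows "ABC_GG_summand G e < 1"
proof -
  obtain u v where e: "e = {u, v}" and ab: "1 \<le> n_closer G u v" "1 \<le> n_closer G v u"
    using edge_endpoints_n_closer_pos[OF assms] .
  define a b where "a = real (n_closer G u v)" and "b = real (n_closer G v u)"
  have ab1: "1 \<le> a" "1 \<le> b" using ab by (auto simp: a_def b_def)
  then have "0 \<le> (a - 1) * (b - 1)" by simp
  then have "a + b - 2 < a * b" by (simp add: algebra_simps)
  moreover have "0 < a * b" using ab1 by simp
  ultimately have "(a + b - 2) / (a * b) < 1" by simp
  then show ?thesis by (simp add: e ABC_GG_summand_doubleton a_def b_def)
qed

lemma ABC_GG_nonneg:
  assumes "pair_graph G"
  shows "0 \<le> ABC_GG G"
  unfolding ABC_GG_def by (intro sum_nonneg ABC_GG_summand_nonneg assms)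

lemma finite_edges:
  assumes "pair_fin_digraph G"
  shows "finite (edges G)"
proof -
  interpret pair_fin_digraph G by fact
  have "edges G = (\<lambda>(u, v). {u, v}) ` parcs G" by (auto simp: edges_def)
  then show ?thesis using pair_finite_arcs by simp
qed

lemma ABC_GG_less_card_edges:
  assumes "pair_graph G" and "edges G \<noteq> {}"
  shows "ABC_GG G < real (card (edges G))"
proof -
  interpret pair_graph G by fact
  have "ABC_GG G < (\<Sum>e\<in>edges G. 1)"
    unfolding ABC_GG_def
    using finite_edges[OF pair_fin_digraph_axioms] assms ABC_GG_summand_less_one
    by (intro sum_strict_mono) auto
  then show ?thesis by simp
qed

lemma connected_imp_edges_nonempty:
  assumes "pair_graph G" and "Digraph_Component.connected (with_proj G)"
    and "u \<in> pverts G" "v \<in> pverts G" "u \<noteq> v"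
  shows "edges G \<noteq> {}"
proof -
  interpret pair_graph G by fact
  have "strongly_connected (with_proj G)"
    using symmetric_connected_imp_strongly_connected sym_arcs assms(2) by blast
  then have "u \<rightarrow>\<^sup>*\<^bsub>with_proj G\<^esub> v" using assms(3,4) by (auto simp: strongly_connected_def)
  then have "(u, v) \<in> (parcs G)\<^sup>+" using reachable_neq_reachable1[of u v] assms(5) by simp
  then obtain w where "(u, w) \<in> parcs G" by (blast dest: tranclD)
  then show ?thesis by (auto simp: edges_def)
qed

text \<open>
  This is what makes the inequality strict. A vertex of the bouquet other than \<open>z\<close> comes
  from a vertex \<open>v \<noteq> x i\<close> of some \<open>G i\<close>; the connected graph \<open>G i\<close> has an edge on the way from
  \<open>v\<close> to \<open>x i\<close>, and gluing maps it to an edge of the bouquet.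
\<close>

lemma bouquet_has_edge:
  assumes gr: "\<And>i. i \<in> {1..n} \<Longrightarrow> pair_graph (G i)"
    and conn: "\<And>i. i \<in> {1..n} \<Longrightarrow> Digraph_Component.connected (with_proj (G i))"
    and x: "\<And>i. i \<in> {1..n} \<Longrightarrow> x i \<in> pverts (G i)"
    and two: "2 \<le> card (pverts (bouquet n G x z))"
  shows "edges (bouquet n G x z) \<noteq> {}"
proof -
  have "\<not> pverts (bouquet n G x z) \<subseteq> {z}"
    using two card_mono[of "{z}" "pverts (bouquet n G x z)"] by auto
  then have "\<exists>i\<in>{1..n}. \<exists>v\<in>pverts (G i). glue n x z v \<noteq> z"
    by (simp add: bouquet_def image_subset_iff)
  then obtain i v where i: "i \<in> {1..n}" and v: "v \<in> pverts (G i)" and "glue n x z v \<noteq> z"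
    by (elim bexE)
  then have "v \<noteq> x i" by (auto simp: glue_def)
  then have "edges (G i) \<noteq> {}"
    using connected_imp_edges_nonempty[OF gr[OF i] conn[OF i] v x[OF i]] by simp
  then have "parcs (G i) \<noteq> {}" by (auto simp: edges_def)
  then have "parcs (bouquet n G x z) \<noteq> {}" using i by (auto simp: bouquet_def)
  then show ?thesis by (auto simp: edges_def)
qed

theorem theorem2p9:
  fixes n :: nat and G :: "nat \<Rightarrow> 'a pair_pre_digraph" and x :: "nat \<Rightarrow> 'a" and z :: 'a
  assumes "1 \<le> n"
    and "\<And>i. i \<in> {1..n} \<Longrightarrow> pair_graph (G i)"
    and "\<And>i. i \<in> {1..n} \<Longrightarrow> Digraph_Component.connected (with_proj (G i))"
    and "disjoint_family_on (\<lambda>i. pverts (G i)) {1..n}"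
    and "\<And>i. i \<in> {1..n} \<Longrightarrow> x i \<in> pverts (G i)"
    and "z \<notin> (\<Union>i\<in>{1..n}. pverts (G i)) - x ` {1..n}"
    and "2 \<le> card (pverts (bouquet n G x z))"
  shows "ABC_GG (bouquet n G x z)
    < real (card (edges (bouquet n G x z)))
      + (\<Sum>i=1..n. ABC_GG (G i))
      + (\<Sum>i=1..n-1. sqrt ((real (card (pverts (bouquet n G x z))) - 2) /
          (real (\<Sum>t=1..i. card (pverts (G t))) * real (\<Sum>t=i+1..n. card (pverts (G t))))))"
proof -
  let ?B = "bouquet n G x z"
  have "pair_graph ?B"
    by (rule pair_graph_bouquet) (fact assms(2,4-6))+
  moreover have "edges ?B \<noteq> {}"
    by (rule bouquet_has_edge[of n G x]) (fact assms(2,3,5,7))+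
  ultimately have "ABC_GG ?B < real (card (edges ?B))" by (rule ABC_GG_less_card_edges)
  moreover have "0 \<le> (\<Sum>i=1..n. ABC_GG (G i))"
    by (intro sum_nonneg ABC_GG_nonneg assms(2))
  moreover have "0 \<le> (\<Sum>i=1..n-1. sqrt ((real (card (pverts ?B)) - 2) /
          (real (\<Sum>t=1..i. card (pverts (G t))) * real (\<Sum>t=i+1..n. card (pverts (G t))))))"
    using assms(7) by (intro sum_nonneg real_sqrt_ge_zero divide_nonneg_nonneg mult_nonneg_nonneg of_nat_0_le_iff) auto
  ultimately show ?thesis by linarith
qed

end
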